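(* Let $d\ge 1$ be an integer such that $n=2d+1$ is a prime number, and let $g$ be a primitive root modulo $n$. Let $$\boldsymbol{z} = \big[ g^0,\, g^{\frac{n-1}{2d}},\, g^{\frac{2(n-1)}{2d}},\, \dots,\, g^{\frac{(d-1)(n-1)}{2d}} \big] \bmod n,$$ and construct the rank-1 lattice $X=\{\boldsymbol{x}_0,\dots,\boldsymbol{x}_{n-1}\}$ with $\boldsymbol{x}_i = \frac{i\boldsymbol{z} \bmod n}{n}$ for $i\in\{0,\dots,n-1\}$. Then, for all $i,j\in\{0,\dots,n-1\}$ with $i\neq j$, $$\|\boldsymbol{x}_i-\boldsymbol{x}_j\|_{T_1}=\frac{(n+1)d}{4n}\qquad\text{and}\qquad \|\boldsymbol{x}_i-\boldsymbol{x}_j\|_{T_2}=\sqrt{\frac{(n+1)d}{12n}}.$$ That is, the pairwise toroidal distances of $X$ attain the upper bounds $\frac{(n+1)d}{4n}$ (for $T_1$) and $\sqrt{\frac{(n+1)d}{12n}}$ (for $T_2$) on the minimum pairwise toroidal distance of rank-1 lattices with $n$ points in dimension $d$ whose generating vector has pairwise distinct components in $\{1,\dots,n-1\}$.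
   Context: For an integer vector $\boldsymbol{v}$, $\boldsymbol{v} \bmod n$ denotes the vector of componentwise residues in $\{0,\dots,n-1\}$. For $\boldsymbol{x},\boldsymbol{x}'\in[0,1]^d$ and $p>0$, the $l_p$-norm-based toroidal distance is $$\|\boldsymbol{x}-\boldsymbol{x}'\|_{T_p} := \Big(\sum_{t=1}^d \big(\min(|x_t-x'_t|,\,1-|x_t-x'_t|)\big)^p\Big)^{1/p}.$$ The rank-1 lattice with $n$ points and generating vector $\boldsymbol{z}\in\mathbb{Z}^d$ is the point set $\{\frac{i\boldsymbol{z}\bmod n}{n} : i=0,\dots,n-1\}$. *)

theory Defs
  imports Complex_Main "HOL-Library.FuncSet" "HOL-Number_Theory.Number_Theory"
begin

text \<open>A vector in dimension \<open>d\<close> is a function on \<open>nat\<close>, of which only the values at the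
  indices \<open>t < d\<close> are relevant.\<close>

text \<open>Only meant for \<open>p > 0\<close> and arguments with components in \<open>[0, 1]\<close>; then the
  summands have non-negative base and \<open>0 powr p = 0\<close>, as expected.\<close>

definition toroidal_dist :: "nat \<Rightarrow> real \<Rightarrow> (nat \<Rightarrow> real) \<Rightarrow> (nat \<Rightarrow> real) \<Rightarrow> real" where
  "toroidal_dist d p x y =
     (\<Sum>t<d. (min \<bar>x t - y t\<bar> (1 - \<bar>x t - y t\<bar>)) powr p) powr (1 / p)"

text \<open>Points are restricted to the indices below \<open>d\<close>, so that two of them are equal as
  functions iff they are equal as points of dimension \<open>d\<close>.\<close>

definition lattice_point :: "nat \<Rightarrow> nat \<Rightarrow> (nat \<Rightarrow> int) \<Rightarrow> nat \<Rightarrow> nat \<Rightarrow> real" where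
  "lattice_point d n z i = (\<lambda>t\<in>{..<d}. real_of_int ((int i * z t) mod int n) / real n)"

definition rank1_lattice :: "nat \<Rightarrow> nat \<Rightarrow> (nat \<Rightarrow> int) \<Rightarrow> (nat \<Rightarrow> real) set" where
  "rank1_lattice d n z = lattice_point d n z ` {0..<n}"

text \<open>Only meant for finite sets with at least two points, where \<open>Min\<close> is the
  minimum of a finite non-empty set.\<close>

definition min_toroidal_dist :: "nat \<Rightarrow> real \<Rightarrow> (nat \<Rightarrow> real) set \<Rightarrow> real" where
  "min_toroidal_dist d p X = Min {toroidal_dist d p x y | x y. x \<in> X \<and> y \<in> X \<and> x \<noteq> y}"

definition distinct_generating_vector :: "nat \<Rightarrow> nat \<Rightarrow> (nat \<Rightarrow> int) \<Rightarrow> bool" where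
  "distinct_generating_vector d n z \<longleftrightarrow>
     inj_on z {..<d} \<and> (\<forall>t<d. z t \<in> {1..int n - 1})"

end

theory Submission
  imports Defs
begin

text \<open>The toroidal distance between points \<open>i\<close> and \<open>j\<close> only involves
  the distances of \<open>(i - j) * z t\<close> to the nearest multiple of \<open>n\<close>. For
  \<open>n = 2 * d + 1\<close> the nonzero residues up to sign are represented by 1, ...,
  \<open>d\<close>, so any \<open>d\<close> integers that are nonzero and pairwise distinct up to
  sign modulo \<open>n\<close> have exactly these distances (\<open>sum_abs_least_residue\<close>).
  This is used along both directions of the table \<open>i * z t\<close>.

  Fix the point difference: the powers \<open>g ^ t\<close> with \<open>t < d\<close> are distinct
  up to sign, since their squares are distinct. So every pair of points has the same distance, the
  \<open>l_p\<close> norm of (1/n, ..., d/n) (\<open>toroidal_dist_primroot_lattice\<close>). Fix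
  the component: for an arbitrary admissible vector, averaging over the points 1, ...,
  \<open>d\<close> yields one whose distance from the origin is at most that norm
  (\<open>min_toroidal_dist_upper_bound\<close>). Both hold for all \<open>p > 0\<close>; only the
  closed forms need \<open>p = 1\<close> and \<open>p = 2\<close>.\<close>

section \<open>Residues up to sign\<close>

text \<open>For \<open>m > 0\<close>, this is the distance from \<open>a\<close> to the nearest
  multiple of \<open>m\<close>.\<close>

definition abs_least_residue :: "int \<Rightarrow> int \<Rightarrow> int" where
  "abs_least_residue m a = min (a mod m) (m - a mod m)"

text \<open>The right-hand side is \<open>m\<close> times the toroidal distance of the coordinates
  \<open>(a mod m) / m\<close> and \<open>(b mod m) / m\<close>, which therefore depends on
  \<open>a - b\<close> alone.\<close>

lemma abs_least_residue_diff:
  assumes "m > 0"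
  shows "abs_least_residue m (a - b) = min \<bar>a mod m - b mod m\<bar> (m - \<bar>a mod m - b mod m\<bar>)"
proof -
  define r s where "r = a mod m" and "s = b mod m"
  have rs: "0 \<le> r" "r < m" "0 \<le> s" "s < m" using assms by (auto simp: r_def s_def)
  have ab: "(a - b) mod m = (r - s) mod m" by (simp add: r_def s_def mod_diff_eq)
  have "abs_least_residue m (a - b) = min \<bar>r - s\<bar> (m - \<bar>r - s\<bar>)"
  proof (cases "s \<le> r")
    case True
    then show ?thesis using rs by (simp add: abs_least_residue_def ab)
  next
    case False
    \<comment> \<open>Here the difference wraps around, and the two arguments of \<open>min\<close>
      trade places.\<close>
    have "(r - s) mod m = (r - s + m) mod m" by simp
    also have "\<dots> = r - s + m" using False rs by (intro mod_pos_pos_trivial) auto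
    finally show ?thesis using False rs by (simp add: abs_least_residue_def ab)
  qed
  then show ?thesis by (simp add: r_def s_def)
qed

lemma abs_least_residue_eqD:
  assumes "abs_least_residue m a = abs_least_residue m b"
  shows "[a = b] (mod m) \<or> [a = - b] (mod m)"
proof -
  have "a mod m = b mod m \<or> a mod m = m - b mod m"
    using assms by (auto simp: abs_least_residue_def min_def split: if_splits)
  then show ?thesis
  proof
    assume "a mod m = m - b mod m"
    then have "a mod m mod m = (m - b mod m) mod m" by simp
    then have "a mod m = (- b) mod m" by (simp add: mod_simps)
    then show ?thesis by (simp add: cong_def)
  qed (simp add: cong_def)
qed

lemma abs_least_residue_range:
  assumes "m = 2 * int d + 1" and "\<not> m dvd a"
  shows "abs_least_residue m a \<in> {1..int d}"
proof -
  have "a mod m \<noteq> 0" using assms(2) by (simp add: dvd_eq_mod_eq_0)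
  moreover have "0 \<le> a mod m" "a mod m < m" using assms(1) pos_mod_sign[of m a] pos_mod_bound[of m a] by linarith+
  ultimately show ?thesis
    using assms(1) unfolding abs_least_residue_def atLeastAtMost_iff by linarith
qed

text \<open>Pigeonhole: \<open>abs_least_residue m\<close> composed with \<open>f\<close> is
  injective from a set of \<open>d\<close> elements into 1, ..., \<open>d\<close>, hence a
  bijection. \<open>A\<close> is a set of points in one application and a set of components in the
  other.\<close>

lemma sum_abs_least_residue:
  fixes f :: "'a \<Rightarrow> int" and F :: "int \<Rightarrow> real"
  assumes m: "m = 2 * int d + 1" and A: "finite A" "card A = d"
    and nz: "\<And>s. s \<in> A \<Longrightarrow> \<not> m dvd f s"
    and inj: "\<And>s t. s \<in> A \<Longrightarrow> t \<in> A \<Longrightarrow> [f s = f t] (mod m) \<or> [f s = - f t] (mod m) \<Longrightarrow> s = t"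
  shows "(\<Sum>s\<in>A. F (abs_least_residue m (f s))) = (\<Sum>k=1..d. F (int k))"
proof -
  let ?h = "\<lambda>s. abs_least_residue m (f s)"
  have h: "inj_on ?h A" by (intro inj_onI inj) (auto dest: abs_least_residue_eqD)
  have "?h ` A = {1..int d}"
  proof (rule card_subset_eq)
    show "?h ` A \<subseteq> {1..int d}" using abs_least_residue_range[OF m nz] by blast
  qed (simp_all add: card_image[OF h] A)
  then have "(\<Sum>s\<in>A. F (?h s)) = sum F {1..int d}"
    using sum.reindex[OF h, of F] by simp
  also have "{1..int d} = int ` {1..d}" by (simp add: image_int_atLeastAtMost)
  also have "sum F (int ` {1..d}) = (\<Sum>k=1..d. F (int k))"
    by (subst sum.reindex) auto
  finally show ?thesis .
qed

section \<open>Toroidal distances in rank-1 lattices\<close>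

lemma toroidal_dist_lattice_point:
  assumes "n > 0"
  shows "toroidal_dist d p (lattice_point d n z i) (lattice_point d n z j) =
    (\<Sum>t<d. (abs_least_residue (int n) ((int i - int j) * z t) / real n) powr p) powr (1 / p)"
proof -
  have "min \<bar>real_of_int a / real n - real_of_int b / real n\<bar>
          (1 - \<bar>real_of_int a / real n - real_of_int b / real n\<bar>)
        = real_of_int (min \<bar>a - b\<bar> (int n - \<bar>a - b\<bar>)) / real n" for a b :: int
  proof -
    have "\<bar>real_of_int a / real n - real_of_int b / real n\<bar> = real_of_int \<bar>a - b\<bar> / real n"
      by (simp flip: diff_divide_distrib)
    moreover have "1 - real_of_int \<bar>a - b\<bar> / real n = real_of_int (int n - \<bar>a - b\<bar>) / real n"
      using assms by (simp add: field_simps)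
    ultimately show ?thesis by (simp add: min_divide_distrib_right of_int_min)
  qed
  then show ?thesis
    using assms by (simp add: toroidal_dist_def lattice_point_def left_diff_distrib
        abs_least_residue_diff)
qed

text \<open>A single component invertible modulo \<open>n\<close> recovers the index. This turns
  distinct indices into distinct points, over which \<open>min_toroidal_dist\<close> ranges.\<close>

lemma inj_on_lattice_point:
  assumes "prime n" and "t < d" and "\<not> int n dvd z t"
  shows "inj_on (lattice_point d n z) {0..<n}"
proof (rule inj_onI)
  fix i j assume ij: "i \<in> {0..<n}" "j \<in> {0..<n}" "lattice_point d n z i = lattice_point d n z j"
  have "lattice_point d n z i t = lattice_point d n z j t" using ij by simp
  then have "[int i * z t = int j * z t] (mod int n)"
    using assms prime_gt_0_nat[of n] by (simp add: lattice_point_def cong_def)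
  moreover have "coprime (z t) (int n)"
    using assms by (metis prime_imp_coprime coprime_commute prime_nat_int_transfer)
  ultimately have "[int i = int j] (mod int n)" by (simp add: cong_mult_rcancel)
  then show "i = j" using ij by (simp add: cong_int_iff cong_def)
qed

lemma finite_toroidal_dists:
  "finite {toroidal_dist d p x y | x y. x \<in> rank1_lattice d n z \<and> y \<in> rank1_lattice d n z \<and> x \<noteq> y}"
proof (rule finite_subset)
  let ?X = "rank1_lattice d n z"
  show "{toroidal_dist d p x y | x y. x \<in> ?X \<and> y \<in> ?X \<and> x \<noteq> y}
      \<subseteq> (\<lambda>(x, y). toroidal_dist d p x y) ` (?X \<times> ?X)" by auto
  show "finite ((\<lambda>(x, y). toroidal_dist d p x y) ` (?X \<times> ?X))"
    by (simp add: rank1_lattice_def)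
qed

lemma min_toroidal_dist_le:
  assumes "inj_on (lattice_point d n z) {0..<n}" and "i < n" "j < n" "i \<noteq> j"
  shows "min_toroidal_dist d p (rank1_lattice d n z)
    \<le> toroidal_dist d p (lattice_point d n z i) (lattice_point d n z j)"
  unfolding min_toroidal_dist_def
proof (rule Min_le[OF finite_toroidal_dists])
  have "lattice_point d n z i \<noteq> lattice_point d n z j"
    using assms by (auto dest: inj_onD)
  then show "toroidal_dist d p (lattice_point d n z i) (lattice_point d n z j) \<in>
    {toroidal_dist d p x y | x y. x \<in> rank1_lattice d n z \<and> y \<in> rank1_lattice d n z \<and> x \<noteq> y}"
    using assms unfolding rank1_lattice_def by fastforce
qed

lemma min_toroidal_dist_eqI:
  assumes "inj_on (lattice_point d n z) {0..<n}" and "n > 1"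
    and "\<And>i j. i < n \<Longrightarrow> j < n \<Longrightarrow> i \<noteq> j \<Longrightarrow>
      toroidal_dist d p (lattice_point d n z i) (lattice_point d n z j) = B"
  shows "min_toroidal_dist d p (rank1_lattice d n z) = B"
proof -
  let ?D = "{toroidal_dist d p x y | x y. x \<in> rank1_lattice d n z \<and> y \<in> rank1_lattice d n z \<and> x \<noteq> y}"
  have "?D \<subseteq> {B}" using assms(3) by (fastforce simp: rank1_lattice_def)
  moreover have "?D \<noteq> {}"
  proof -
    have "lattice_point d n z 0 \<noteq> lattice_point d n z 1"
      using assms by (auto dest: inj_onD)
    then show ?thesis using assms(2) by (fastforce simp: rank1_lattice_def)
  qed
  ultimately have "?D = {B}" by blast
  then show ?thesis by (simp only: min_toroidal_dist_def Min_singleton)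
qed

section \<open>The upper bound by averaging\<close>

lemma not_dvd_of_range:
  fixes a :: int
  assumes "a \<in> {1..int n - 1}"
  shows "\<not> int n dvd a"
  using assms by (auto dest: zdvd_imp_le)

text \<open>For a fixed component \<open>t\<close>, the residues of \<open>i * w t\<close> with \<open>1 \<le> i \<le> d\<close> run
  through \<open>1, \<dots>, d\<close> up to sign, so already the points \<open>1, \<dots>, d\<close> have the right average
  distance from the origin.\<close>

lemma min_toroidal_dist_upper_bound:
  assumes d: "d \<ge> 1" and n: "n = 2 * d + 1" "prime n" and p: "p > 0"
    and w: "distinct_generating_vector d n w"
  shows "min_toroidal_dist d p (rank1_lattice d n w) \<le> (\<Sum>k=1..d. (real k / real n) powr p) powr (1 / p)"
proof -
  let ?S = "\<Sum>k=1..d. (real k / real n) powr p"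
  let ?T = "\<lambda>i. \<Sum>t<d. (abs_least_residue (int n) (int i * w t) / real n) powr p"
  have pr: "prime (int n)" using n(2) by (metis prime_nat_int_transfer)
  have wt: "\<not> int n dvd w t" if "t < d" for t
    using that w by (intro not_dvd_of_range) (auto simp: distinct_generating_vector_def)
  have col: "(\<Sum>i=1..d. (abs_least_residue (int n) (int i * w t) / real n) powr p) = ?S"
    if t: "t < d" for t
  proof -
    have "(\<Sum>i\<in>{1..d}. (\<lambda>r. (real_of_int r / real n) powr p) (abs_least_residue (int n) (int i * w t)))
      = (\<Sum>k=1..d. (\<lambda>r. (real_of_int r / real n) powr p) (int k))"
    proof (rule sum_abs_least_residue)
      fix i assume i: "i \<in> {1..d}"
      then have "\<not> int n dvd int i" using n by (intro not_dvd_of_range) auto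
      then show "\<not> int n dvd int i * w t" using wt[OF t] pr by (simp add: prime_dvd_mult_iff)
      fix j assume j: "j \<in> {1..d}"
        and "[int i * w t = int j * w t] (mod int n) \<or> [int i * w t = - (int j * w t)] (mod int n)"
      then have "int n dvd (int i - int j) * w t \<or> int n dvd (int i + int j) * w t"
        by (simp add: cong_iff_dvd_diff algebra_simps)
      then have "int n dvd int i - int j \<or> int n dvd int i + int j"
        using wt[OF t] pr by (simp add: prime_dvd_mult_iff)
      \<comment> \<open>\<open>i + j\<close> lies between 2 and \<open>2 * d = n - 1\<close>; this
        excludes agreement up to a minus sign.\<close>
      moreover have "\<not> int n dvd int i + int j"
        using i j n by (intro not_dvd_of_range) auto
      ultimately have "[int i = int j] (mod int n)" by (simp add: cong_iff_dvd_diff)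
      then show "i = j" using i j n by (simp add: cong_int_iff cong_def)
    qed (use n in auto)
    then show ?thesis by simp
  qed
  have "(\<Sum>i=1..d. ?T i) = (\<Sum>t<d. ?S)"
    by (subst sum.swap) (rule sum.cong, simp_all only: col lessThan_iff)
  \<comment> \<open>There are as many chosen points as components, so the average of
    \<open>?T i\<close> over these points is \<open>?S\<close>.\<close>
  also have "\<dots> = (\<Sum>i=1..d. ?S)" by simp
  finally have eq: "(\<Sum>i=1..d. ?T i) = (\<Sum>i=1..d. ?S)" .
  obtain i where i: "i \<in> {1..d}" "?T i \<le> ?S"
  proof (rule ccontr)
    assume "\<not> thesis"
    then have "(\<Sum>i=1..d. ?S) < (\<Sum>i=1..d. ?T i)"
      using d that by (intro sum_strict_mono) (auto simp: not_le[symmetric])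
    then show False using eq by simp
  qed
  have "min_toroidal_dist d p (rank1_lattice d n w)
      \<le> toroidal_dist d p (lattice_point d n w i) (lattice_point d n w 0)"
    using inj_on_lattice_point[of n 0 d w] wt d i n by (intro min_toroidal_dist_le) auto
  also have "\<dots> = ?T i powr (1 / p)" using n by (simp add: toroidal_dist_lattice_point)
  also have "\<dots> \<le> ?S powr (1 / p)"
    using i p by (intro powr_mono2 sum_nonneg) auto
  finally show ?thesis .
qed

section \<open>The generating vector of powers of a primitive root\<close>

lemma primroot_power_cong_iff:
  assumes "n = 2 * d + 1" "prime n" "residue_primroot n g"
  shows "[int g ^ s = int g ^ t] (mod int n) \<longleftrightarrow> [s = t] (mod 2 * d)"
proof -
  have "ord n g = 2 * d" "coprime n g"
    using assms by (auto simp: residue_primroot_def totient_prime)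
  then have "[g ^ s = g ^ t] (mod n) \<longleftrightarrow> [s = t] (mod 2 * d)"
    using order_divides_expdiff by metis
  then show ?thesis by (metis cong_int_iff of_nat_power)
qed

text \<open>Powers of \<open>g\<close> are units modulo \<open>n\<close>, and exponents below
  \<open>d\<close> are distinct modulo the order \<open>2 * d\<close>. So \<open>z\<close> belongs
  to the class for which the upper bound is stated.\<close>

lemma primroot_distinct_generating_vector:
  assumes n: "n = 2 * d + 1" "prime n" and g: "residue_primroot n g"
    and z: "\<And>t. t < d \<Longrightarrow> z t = int g ^ t mod int n"
  shows "distinct_generating_vector d n z"
  unfolding distinct_generating_vector_def
proof (intro conjI allI impI inj_onI)
  fix s t assume st: "s \<in> {..<d}" "t \<in> {..<d}" "z s = z t"
  then have "[int g ^ s = int g ^ t] (mod int n)" by (simp add: z cong_def)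
  then have "[s = t] (mod 2 * d)" using primroot_power_cong_iff[OF n g] by simp
  then show "s = t" using st by (simp add: cong_def)
next
  fix t assume t: "t < d"
  have "\<not> n dvd g ^ t"
  proof
    assume "n dvd g ^ t"
    then have "n dvd g" using n(2) prime_dvd_power by blast
    then show False
      using g prime_gt_1_nat[OF n(2)] by (auto simp: residue_primroot_def coprime_absorb_left)
  qed
  then have "int g ^ t mod int n \<noteq> 0"
    by (metis dvd_eq_mod_eq_0 of_nat_dvd_iff of_nat_power)
  moreover have "0 \<le> int g ^ t mod int n" "int g ^ t mod int n < int n"
    using prime_gt_0_nat[OF n(2)] by auto
  ultimately show "z t \<in> {1..int n - 1}" using t by (simp add: z)
qed

text \<open>Dually, here the point is fixed and the component varies: \<open>c * g ^ s\<close> and \<open>c * g ^ t\<close>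
  can only agree up to sign if \<open>g ^ (2 * s)\<close> and \<open>g ^ (2 * t)\<close> agree, i.e.\ if \<open>d\<close>
  divides \<open>s - t\<close>.\<close>

lemma toroidal_dist_primroot_lattice:
  assumes n: "n = 2 * d + 1" "prime n" and g: "residue_primroot n g"
    and z: "\<And>t. t < d \<Longrightarrow> z t = int g ^ t mod int n"
    and ij: "i < n" "j < n" "i \<noteq> j"
  shows "toroidal_dist d p (lattice_point d n z i) (lattice_point d n z j)
    = (\<Sum>k=1..d. (real k / real n) powr p) powr (1 / p)"
proof -
  define c where "c = int i - int j"
  have pr: "prime (int n)" using n(2) by (metis prime_nat_int_transfer)
  have c: "\<not> int n dvd c"
  proof
    assume "int n dvd c"
    then have "[i = j] (mod n)" by (simp add: c_def flip: cong_iff_dvd_diff cong_int_iff)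
    then show False using ij by (simp add: cong_def)
  qed
  have zt: "\<not> int n dvd z t" if "t < d" for t
    using that primroot_distinct_generating_vector[OF n g z]
    by (intro not_dvd_of_range) (auto simp: distinct_generating_vector_def)
  have "(\<Sum>t\<in>{..<d}. (\<lambda>r. (real_of_int r / real n) powr p) (abs_least_residue (int n) (c * z t)))
    = (\<Sum>k=1..d. (\<lambda>r. (real_of_int r / real n) powr p) (int k))"
  proof (rule sum_abs_least_residue)
    fix s assume s: "s \<in> {..<d}"
    then show "\<not> int n dvd c * z s" using c zt pr by (simp add: prime_dvd_mult_iff)
    fix t assume t: "t \<in> {..<d}"
      and "[c * z s = c * z t] (mod int n) \<or> [c * z s = - (c * z t)] (mod int n)"
    then have "int n dvd c * (z s - z t) \<or> int n dvd c * (z s + z t)"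
      by (simp add: cong_iff_dvd_diff algebra_simps)
    \<comment> \<open>The product merges both signs into one congruence between squares, hence
      between powers of \<open>g\<close> with exponents \<open>2 * s\<close> and
      \<open>2 * t\<close>, both below \<open>2 * d\<close>.\<close>
    then have "int n dvd (z s - z t) * (z s + z t)"
      using c pr by (auto simp: prime_dvd_mult_iff)
    then have "[z s ^ 2 = z t ^ 2] (mod int n)"
      by (simp add: cong_iff_dvd_diff algebra_simps power2_eq_square)
    then have "[(int g ^ s) ^ 2 = (int g ^ t) ^ 2] (mod int n)"
      using s t by (simp add: z cong_def power_mod)
    then have "[2 * s = 2 * t] (mod 2 * d)"
      using primroot_power_cong_iff[OF n g, of "2 * s" "2 * t"]
      by (simp add: mult.commute flip: power_mult)
    then show "s = t" using s t by (simp add: cong_def)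
  qed (use n in auto)
  then show ?thesis using n by (simp add: toroidal_dist_lattice_point c_def)
qed

section \<open>Closed forms and conclusion\<close>

text \<open>The sum of the first \<open>d\<close> integers, with \<open>d + 1 = (n + 1) / 2\<close>.
  The trivial exponents stay so that the equation rewrites the case \<open>p = 1\<close> of the
  general results.\<close>

lemma sum_fractions:
  assumes "n = 2 * d + 1"
  shows "(\<Sum>k=1..d. (real k / real n) powr 1) powr (1 / 1) = (real n + 1) * real d / (4 * real n)"
proof -
  have "(\<Sum>k=1..m. real k) = real m * (real m + 1) / 2" for m
    by (induction m) (auto simp: field_simps)
  then have "(\<Sum>k=1..d. real k / real n) = real d * (real d + 1) / 2 / real n"
    by (simp only: flip: sum_divide_distrib)
  also have "\<dots> = (real n + 1) * real d / (4 * real n)"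
    using assms by (simp add: divide_simps) (simp add: algebra_simps)
  finally have "(\<Sum>k=1..d. real k / real n) = (real n + 1) * real d / (4 * real n)" .
  then show ?thesis by simp
qed

text \<open>In the sum of the first \<open>d\<close> squares the factor \<open>2 * d + 1\<close> is
  \<open>n\<close> and cancels one of the two in the denominator.\<close>

lemma sum_square_fractions:
  assumes "n = 2 * d + 1"
  shows "(\<Sum>k=1..d. (real k / real n) powr 2) powr (1 / 2) = sqrt ((real n + 1) * real d / (12 * real n))"
proof -
  have "(\<Sum>k=1..m. real k ^ 2) = real m * (real m + 1) * (2 * real m + 1) / 6" for m
    by (induction m) (auto simp: field_simps power2_eq_square)
  then have "(\<Sum>k=1..d. (real k / real n) ^ 2) = real d * (real d + 1) * (2 * real d + 1) / 6 / real n ^ 2"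
    by (simp only: power_divide flip: sum_divide_distrib)
  also have "\<dots> = (real n + 1) * real d / (12 * real n)"
    using assms by (simp add: divide_simps power2_eq_square) (simp add: algebra_simps)
  finally show ?thesis by (simp add: powr_half_sqrt)
qed

theorem corollary1:
  fixes d n g :: nat and z :: "nat \<Rightarrow> int" and x :: "nat \<Rightarrow> nat \<Rightarrow> real"
  assumes "d \<ge> 1" and "n = 2 * d + 1" and "prime n" and "residue_primroot n g"
    and "\<And>t. t < d \<Longrightarrow> z t = int g ^ (t * (n - 1) div (2 * d)) mod int n"
    and "\<And>i. i < n \<Longrightarrow> x i = lattice_point d n z i"
  shows "(\<forall>i<n. \<forall>j<n. i \<noteq> j \<longrightarrow>
            toroidal_dist d 1 (x i) (x j) = (real n + 1) * real d / (4 * real n) \<and>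
            toroidal_dist d 2 (x i) (x j) = sqrt ((real n + 1) * real d / (12 * real n)))
       \<and> distinct_generating_vector d n z
       \<and> min_toroidal_dist d 1 (rank1_lattice d n z) = (real n + 1) * real d / (4 * real n)
       \<and> min_toroidal_dist d 2 (rank1_lattice d n z) = sqrt ((real n + 1) * real d / (12 * real n))
       \<and> (\<forall>w. distinct_generating_vector d n w \<longrightarrow>
            min_toroidal_dist d 1 (rank1_lattice d n w) \<le> (real n + 1) * real d / (4 * real n) \<and>
            min_toroidal_dist d 2 (rank1_lattice d n w)
              \<le> sqrt ((real n + 1) * real d / (12 * real n)))"
proof -
  note n = assms(2,3) and g = assms(4)
  \<comment> \<open>Since \<open>n - 1 = 2 * d\<close> is positive, the stated exponent is just
    \<open>t\<close>.\<close>
  have z: "z t = int g ^ t mod int n" if "t < d" for t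
    using assms(5)[OF that] assms(1,2) by simp
  have w: "distinct_generating_vector d n z"
    using primroot_distinct_generating_vector[OF n g z] .
  then have inj: "inj_on (lattice_point d n z) {0..<n}"
    using assms(1) by (intro inj_on_lattice_point[OF n(2), of 0] not_dvd_of_range)
      (auto simp: distinct_generating_vector_def)
  note dist = toroidal_dist_primroot_lattice[OF n g z]
  have "n > 1" using prime_gt_1_nat[OF n(2)] .
  note min_dist = min_toroidal_dist_eqI[OF inj this dist]
  note bound = min_toroidal_dist_upper_bound[OF assms(1) n]
  note sums = sum_fractions[OF n(1)] sum_square_fractions[OF n(1)]
  show ?thesis
    using dist[of _ _ 1] dist[of _ _ 2] min_dist[of 1] min_dist[of 2]
      bound[of 1] bound[of 2] w assms(6)
    unfolding sums by simp
qed

end
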